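(* Let $S\subset E^3$ be a regular (smooth, immersed) surface not passing through the origin, parameterized by the position vector $\mathbf r=\mathbf r(u^1,u^2)$ on a domain $D\subset\mathbb R^2$, and let $\mathbf n$ be the unit normal vector field of $S$. Let the source of rays be at the origin (spherical incident front), and denote by $\mathbf a=\frac{\mathbf r}{r}$, $r=|\mathbf r|$, the direction of the incident rays. Assume $(\mathbf a,\mathbf n)<0$ everywhere on $S$ and put $\cos\theta=(\mathbf a,\mathbf n)$. Denote by $k_i^{*}$ $(i=1,2)$ the solutions (counted with multiplicity) of $$\left(k^{*}+\frac1r\right)^{2}+2\cos\theta\left(2H+k_n(a_t)\tan^{2}\theta\right)\left(k^{*}+\frac1r\right)+4K=0,$$ where $H$ is the mean curvature of $S$, $K$ is the Gaussian curvature of $S$, and $k_n(a_t)$ is the normal curvature of $S$ in the direction of the tangential projection $a_t$ of the incident rays. Then, over each local domain where $k_i^{*}\neq0$, the parametric equations of the caustics of the reflected front can be given by $$\boldsymbol\xi_i^{*}=\mathbf r+\frac{1}{k_i^{*}}\,\mathbf b,$$ where $\mathbf b=\mathbf a-2(\mathbf a,\mathbf n)\mathbf n$ is the direction of the reflected rays.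
   Context: $(\cdot,\cdot)$ is the Euclidean dot product in $E^3$. The first and second fundamental forms of $S$ are $g_{ij}=(\partial_i\mathbf r,\partial_j\mathbf r)$ and $B_{ij}=-(\partial_i\mathbf r,\partial_j\mathbf n)$. The principal curvatures $k_1,k_2$ are the eigenvalues of $B$ relative to $g$, with $2H=k_1+k_2$ and $K=k_1k_2$ (so the unit sphere with inward normal has $k_1=k_2=1$). The tangential projection is $a_t=\mathbf a-(\mathbf a,\mathbf n)\mathbf n$, and $k_n(a_t)=B(a_t,a_t)/g(a_t,a_t)$ where $a_t\ne0$. At points where $a_t=0$ one has $\tan\theta=0$ and the term $k_n(a_t)\tan^2\theta$ is understood as $0$. Only $\cos\theta=(\mathbf a,\mathbf n)$ and $\tan^2\theta=(1-\cos^2\theta)/\cos^2\theta$ enter. The reflected front is $\boldsymbol\rho=\mathbf r+\lambda\mathbf b$ with $\lambda=L-r$, where $L$ is the total distance travelled from the source; it has unit normal field $\mathbf b$. The caustic of the reflected front is its focal set, i.e. the envelope of the family of reflected rays $t\mapsto\mathbf r(u)+t\,\mathbf b(u)$ (extended to full lines, so $t$ may have any sign). Precisely, it is the set of points $\mathbf r(u)+t\,\mathbf b(u)$ at which the differential of the map $(u^1,u^2,t)\mapsto\mathbf r(u^1,u^2)+t\,\mathbf b(u^1,u^2)$ is degenerate. Its sheets (at most two over each local domain, counted with multiplicity, possibly coinciding or degenerating to curves or points) are indexed by $i=1,2$; where $k_i^*=0$ the corresponding focal point is at infinity. *)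

theory Defs
  imports "HOL-Analysis.Analysis" "HOL-Computational_Algebra.Polynomial"
begin

(* C^k and C^infinity maps on an open set, by iterated directional derivatives. *)

fun Ck_on :: "nat \<Rightarrow> ('a::real_normed_vector \<Rightarrow> 'b::real_normed_vector) \<Rightarrow> 'a set \<Rightarrow> bool" where
  "Ck_on 0 f S \<longleftrightarrow> continuous_on S f"
| "Ck_on (Suc k) f S \<longleftrightarrow>
     (\<forall>x\<in>S. f differentiable (at x)) \<and> (\<forall>v. Ck_on k (\<lambda>x. frechet_derivative f (at x) v) S)"

definition smooth_on :: "('a::real_normed_vector \<Rightarrow> 'b::real_normed_vector) \<Rightarrow> 'a set \<Rightarrow> bool" where
  "smooth_on f S \<longleftrightarrow> (\<forall>k. Ck_on k f S)"

definition partial_deriv :: "2 \<Rightarrow> (real^2 \<Rightarrow> real^3) \<Rightarrow> real^2 \<Rightarrow> real^3" where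
  "partial_deriv i f u = frechet_derivative f (at u) (axis i 1)"

definition regular_surface :: "(real^2 \<Rightarrow> real^3) \<Rightarrow> (real^2) set \<Rightarrow> bool" where
  "regular_surface r D \<longleftrightarrow> smooth_on r D \<and> (\<forall>u\<in>D. inj (frechet_derivative r (at u)))"

definition unit_normal_field :: "(real^2 \<Rightarrow> real^3) \<Rightarrow> (real^2 \<Rightarrow> real^3) \<Rightarrow> (real^2) set \<Rightarrow> bool" where
  "unit_normal_field n r D \<longleftrightarrow>
     smooth_on n D \<and> (\<forall>u\<in>D. norm (n u) = 1 \<and> (\<forall>i. n u \<bullet> partial_deriv i r u = 0))"

definition first_form :: "(real^2 \<Rightarrow> real^3) \<Rightarrow> real^2 \<Rightarrow> real^2^2" where
  "first_form r u = (\<chi> i j. partial_deriv i r u \<bullet> partial_deriv j r u)"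

definition second_form :: "(real^2 \<Rightarrow> real^3) \<Rightarrow> (real^2 \<Rightarrow> real^3) \<Rightarrow> real^2 \<Rightarrow> real^2^2" where
  "second_form r n u = (\<chi> i j. - (partial_deriv i r u \<bullet> partial_deriv j n u))"

definition principal_curvatures :: "(real^2 \<Rightarrow> real^3) \<Rightarrow> (real^2 \<Rightarrow> real^3) \<Rightarrow> real^2 \<Rightarrow> real set" where
  "principal_curvatures r n u =
     {k. \<exists>v. v \<noteq> 0 \<and> second_form r n u *v v = k *\<^sub>R (first_form r u *v v)}"

(* B is symmetric and g is positive definite, so there are one or two eigenvalues, and a single
   one is double: the minimum and the maximum are the two eigenvalues with multiplicity. *)

definition mean_curvature :: "(real^2 \<Rightarrow> real^3) \<Rightarrow> (real^2 \<Rightarrow> real^3) \<Rightarrow> real^2 \<Rightarrow> real" where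
  "mean_curvature r n u =
     (Min (principal_curvatures r n u) + Max (principal_curvatures r n u)) / 2"

definition gauss_curvature :: "(real^2 \<Rightarrow> real^3) \<Rightarrow> (real^2 \<Rightarrow> real^3) \<Rightarrow> real^2 \<Rightarrow> real" where
  "gauss_curvature r n u =
     Min (principal_curvatures r n u) * Max (principal_curvatures r n u)"

definition tangent_coords :: "(real^2 \<Rightarrow> real^3) \<Rightarrow> real^2 \<Rightarrow> real^3 \<Rightarrow> real^2" where
  "tangent_coords r u w = (THE v. frechet_derivative r (at u) v = w)"

(* Normal curvature in the direction of the tangent vector w of E^3; its value is 0 at w = 0. *)

definition normal_curvature ::
  "(real^2 \<Rightarrow> real^3) \<Rightarrow> (real^2 \<Rightarrow> real^3) \<Rightarrow> real^2 \<Rightarrow> real^3 \<Rightarrow> real" where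
  "normal_curvature r n u w =
     (let v = tangent_coords r u w
      in (v \<bullet> (second_form r n u *v v)) / (v \<bullet> (first_form r u *v v)))"

definition incident_dir :: "(real^2 \<Rightarrow> real^3) \<Rightarrow> real^2 \<Rightarrow> real^3" where
  "incident_dir r u = r u /\<^sub>R norm (r u)"

definition incident_tangent ::
  "(real^2 \<Rightarrow> real^3) \<Rightarrow> (real^2 \<Rightarrow> real^3) \<Rightarrow> real^2 \<Rightarrow> real^3" where
  "incident_tangent r n u = incident_dir r u - (incident_dir r u \<bullet> n u) *\<^sub>R n u"

definition reflected_dir :: "(real^2 \<Rightarrow> real^3) \<Rightarrow> (real^2 \<Rightarrow> real^3) \<Rightarrow> real^2 \<Rightarrow> real^3" where
  "reflected_dir r n u = incident_dir r u - (2 * (incident_dir r u \<bullet> n u)) *\<^sub>R n u"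

definition cos_incidence :: "(real^2 \<Rightarrow> real^3) \<Rightarrow> (real^2 \<Rightarrow> real^3) \<Rightarrow> real^2 \<Rightarrow> real" where
  "cos_incidence r n u = incident_dir r u \<bullet> n u"

definition tan2_incidence :: "(real^2 \<Rightarrow> real^3) \<Rightarrow> (real^2 \<Rightarrow> real^3) \<Rightarrow> real^2 \<Rightarrow> real" where
  "tan2_incidence r n u = (1 - (cos_incidence r n u)\<^sup>2) / (cos_incidence r n u)\<^sup>2"

(* The left-hand side of the quadratic equation, as a polynomial in the unknown k*;
   [:1/|r|, 1:] is k* + 1/|r|. *)

definition reflection_poly :: "(real^2 \<Rightarrow> real^3) \<Rightarrow> (real^2 \<Rightarrow> real^3) \<Rightarrow> real^2 \<Rightarrow> real poly" where
  "reflection_poly r n u =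
     [:1 / norm (r u), 1:] ^ 2
     + smult (2 * cos_incidence r n u *
              (2 * mean_curvature r n u
               + normal_curvature r n u (incident_tangent r n u) * tan2_incidence r n u))
         [:1 / norm (r u), 1:]
     + [:4 * gauss_curvature r n u:]"

definition ray_map ::
  "(real^2 \<Rightarrow> real^3) \<Rightarrow> (real^2 \<Rightarrow> real^3) \<Rightarrow> (real^2) \<times> real \<Rightarrow> real^3" where
  "ray_map r b = (\<lambda>(u, t). r u + t *\<^sub>R b u)"

definition focal_param ::
  "(real^2 \<Rightarrow> real^3) \<Rightarrow> (real^2 \<Rightarrow> real^3) \<Rightarrow> real^2 \<Rightarrow> real \<Rightarrow> bool" where
  "focal_param r b u t \<longleftrightarrow> \<not> inj (frechet_derivative (ray_map r b) (at (u, t)))"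

(* Multiplicity of a focal point on its ray: the nullity of the differential (0 if not focal). *)

definition focal_multiplicity ::
  "(real^2 \<Rightarrow> real^3) \<Rightarrow> (real^2 \<Rightarrow> real^3) \<Rightarrow> real^2 \<Rightarrow> real \<Rightarrow> nat" where
  "focal_multiplicity r b u t = dim {x. frechet_derivative (ray_map r b) (at (u, t)) x = 0}"

definition caustic ::
  "(real^2 \<Rightarrow> real^3) \<Rightarrow> (real^2 \<Rightarrow> real^3) \<Rightarrow> (real^2) set \<Rightarrow> (real^3) set" where
  "caustic r b U = {ray_map r b (u, t) | u t. u \<in> U \<and> focal_param r b u t}"

definition caustic_sheet ::
  "(real^2 \<Rightarrow> real^3) \<Rightarrow> (real^2 \<Rightarrow> real^3) \<Rightarrow> (real^2 \<Rightarrow> real) \<Rightarrow> real^2 \<Rightarrow> real^3" where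
  "caustic_sheet r n k u = r u + (1 / k u) *\<^sub>R reflected_dir r n u"

end

(*
  In a frame of principal directions the differential of the ray map at parameter t reduces
  to the operator (1 + t/|r|) I + 2 t cos(theta) M on the tangent plane, where M = (I + w w^T) S,
  w = a_t / cos(theta) and S is the shape operator. Hence t is focal iff x = 1/t + 1/|r| is an
  eigenvalue of -2 cos(theta) M, and since tr M = 2H + k_n(a_t) tan^2(theta) and
  det M = K (1 + |w|^2) = K / cos^2(theta), the characteristic polynomial of -2 cos(theta) M is the
  quadratic of the theorem. M is self-adjoint for the inner product (I + w w^T)^(-1), so its
  eigenvalues are real, and a double root forces M to be scalar: nullity equals multiplicity.
*)
theory Submission
  imports Defs
begin

text \<open>The argument is pointwise: the focal condition at (u, t) involves only the first
  derivatives of \<open>r\<close> and \<open>n\<close> at u. Second derivatives of \<open>r\<close>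
  enter once, to make the second fundamental form symmetric, through a mixed derivative theorem
  stated for directional derivatives, the form in which \<open>smooth_on\<close> supplies them. The
  obstacle is that M is in general not a symmetric matrix in an orthonormal frame. In principal
  coordinates its self-adjointness becomes the identity (tr M)^2 - 4 det M = (M11 - M22)^2 + 4 M12
  M21 with M12 M21 = K (w1 w2)^2. For K >= 0 both summands are nonnegative, and they vanish together
  only if M is scalar; for K < 0 the determinant is negative. Since cos(theta) does not vanish, the
  normal component of the kernel equation can be solved for the coordinate along the ray, which
  leaves two equations on the tangent plane.\<close>

section \<open>Symmetry of mixed second derivatives\<close>

text \<open>The mean value theorem along v, applied to the difference of \<open>f\<close> on two
  parallel edges, turns the mixed difference into s times a difference of two values of
  \<open>f' _ v\<close>; the derivative \<open>L\<close> at x evaluates that difference as s times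
  \<open>L w\<close>, up to a small error.\<close>

lemma second_difference_quotient:
  fixes f :: "'a::real_normed_vector \<Rightarrow> real"
  assumes S: "open S" "x \<in> S"
    and f: "\<And>y. y \<in> S \<Longrightarrow> (f has_derivative f' y) (at y)"
    and L: "((\<lambda>y. f' y v) has_derivative L) (at x)"
    and e: "e > 0"
  shows "\<exists>d>0. \<forall>s. 0 < s \<and> s < d \<longrightarrow>
    \<bar>f (x + s *\<^sub>R v + s *\<^sub>R w) - f (x + s *\<^sub>R v) - f (x + s *\<^sub>R w) + f x - s\<^sup>2 * L w\<bar> \<le> e * s\<^sup>2"
proof -
  \<comment> \<open>On the parallelogram with sides s v and s w the distance to x is at most s * C;
    the summand 1 keeps C positive when v = w = 0.\<close>
  define C where "C = norm v + norm w + 1"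
  have C: "C > 0" unfolding C_def by (smt (verit) norm_ge_zero)
  obtain d0 where d0: "d0 > 0" "ball x d0 \<subseteq> S" using S open_contains_ball by blast
  \<comment> \<open>With this tolerance each of the two edges contributes an error of at most e / 2
    * s.\<close>
  have "e / (2 * C) > 0" using e C by simp
  then obtain d1 where d1: "d1 > 0"
    "\<And>y. norm (y - x) < d1 \<Longrightarrow> \<bar>f' y v - f' x v - L (y - x)\<bar> \<le> e / (2 * C) * norm (y - x)"
    using L unfolding has_derivative_at_alt real_norm_def by blast
  interpret L: bounded_linear L using L by (rule has_derivative_bounded_linear)
  show ?thesis
  proof (intro exI conjI allI impI)
    show "min d0 d1 / C > 0" using d0 d1 C by simp
    fix s assume s: "0 < s \<and> s < min d0 d1 / C"
    have sC: "s * C < d0" "s * C < d1" using s C by (simp_all add: pos_less_divide_eq)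
    have near: "norm (\<tau> *\<^sub>R v + \<sigma> *\<^sub>R w) \<le> s * C"
      if "0 \<le> \<tau>" "\<tau> \<le> s" "0 \<le> \<sigma>" "\<sigma> \<le> s" for \<tau> \<sigma>
    proof -
      have "norm (\<tau> *\<^sub>R v + \<sigma> *\<^sub>R w) \<le> \<tau> * norm v + \<sigma> * norm w"
        using that norm_triangle_ineq[of "\<tau> *\<^sub>R v" "\<sigma> *\<^sub>R w"] by simp
      also have "\<dots> \<le> s * norm v + s * norm w" using that by (intro add_mono mult_right_mono) auto
      also have "\<dots> \<le> s * C" using s unfolding C_def by (simp add: algebra_simps)
      finally show ?thesis .
    qed
    have inS: "x + (\<tau> *\<^sub>R v + \<sigma> *\<^sub>R w) \<in> S"
      if "0 \<le> \<tau>" "\<tau> \<le> s" "0 \<le> \<sigma>" "\<sigma> \<le> s" for \<tau> \<sigma>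
      using near[OF that] sC d0(2) by (auto simp: dist_norm norm_minus_commute subset_iff)
    have est: "\<bar>f' (x + (\<tau> *\<^sub>R v + \<sigma> *\<^sub>R w)) v - f' x v - L (\<tau> *\<^sub>R v + \<sigma> *\<^sub>R w)\<bar> \<le> e / 2 * s"
      if "0 \<le> \<tau>" "\<tau> \<le> s" "0 \<le> \<sigma>" "\<sigma> \<le> s" for \<tau> \<sigma>
    proof -
      have "\<bar>f' (x + (\<tau> *\<^sub>R v + \<sigma> *\<^sub>R w)) v - f' x v - L (\<tau> *\<^sub>R v + \<sigma> *\<^sub>R w)\<bar>
          \<le> e / (2 * C) * norm (\<tau> *\<^sub>R v + \<sigma> *\<^sub>R w)"
        using d1(2)[of "x + (\<tau> *\<^sub>R v + \<sigma> *\<^sub>R w)"] near[OF that] sC by simp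
      also have "\<dots> \<le> e / (2 * C) * (s * C)"
        using near[OF that] e C by (intro mult_left_mono) auto
      finally show ?thesis using C by simp
    qed
    \<comment> \<open>The mixed difference is \<open>\<phi> s - \<phi> 0\<close>. The term
      \<open>0 *\<^sub>R w\<close> gives both edges the shape to which \<open>line\<close> and
      \<open>est\<close> apply.\<close>
    define \<phi> where "\<phi> \<tau> = f (x + (\<tau> *\<^sub>R v + s *\<^sub>R w)) - f (x + (\<tau> *\<^sub>R v + 0 *\<^sub>R w))" for \<tau>
    define \<phi>' where "\<phi>' \<tau> = f' (x + (\<tau> *\<^sub>R v + s *\<^sub>R w)) v - f' (x + (\<tau> *\<^sub>R v + 0 *\<^sub>R w)) v" for \<tau>
    have line: "((\<lambda>\<tau>. f (x + (\<tau> *\<^sub>R v + \<sigma> *\<^sub>R w))) has_derivative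
        (\<lambda>h. h * f' (x + (\<tau> *\<^sub>R v + \<sigma> *\<^sub>R w)) v)) (at \<tau>)"
      if "0 \<le> \<tau>" "\<tau> \<le> s" "0 \<le> \<sigma>" "\<sigma> \<le> s" for \<tau> \<sigma>
    proof -
      note fd = f[OF inS[OF that]]
      have lin: "linear (f' (x + (\<tau> *\<^sub>R v + \<sigma> *\<^sub>R w)))"
        using fd by (rule has_derivative_linear)
      have "((\<lambda>\<tau>. x + (\<tau> *\<^sub>R v + \<sigma> *\<^sub>R w)) has_derivative (\<lambda>h. h *\<^sub>R v)) (at \<tau>)"
        by (auto intro!: derivative_eq_intros)
      from has_derivative_compose[OF this fd]
      show ?thesis by (simp add: linear_scale[OF lin])
    qed
    have "(\<phi> has_derivative (\<lambda>h. h * \<phi>' \<tau>)) (at \<tau>)" if "0 \<le> \<tau>" "\<tau> \<le> s" for \<tau>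
      unfolding \<phi>_def \<phi>'_def right_diff_distrib
      using line[OF that, of s] line[OF that, of 0] s by (intro has_derivative_diff) auto
    then have "\<exists>z. z > 0 \<and> z < s \<and> \<phi> s - \<phi> 0 = (s - 0) * \<phi>' z"
      using s by (intro MVT2) (auto simp: has_field_derivative_def mult_commute_abs)
    then obtain z where z: "0 < z" "z < s" "\<phi> s - \<phi> 0 = s * \<phi>' z" by auto
    have *: "\<bar>\<phi>' z - s * L w\<bar> \<le> e * s"
    proof -
      have "\<phi>' z - s * L w = (f' (x + (z *\<^sub>R v + s *\<^sub>R w)) v - f' x v - L (z *\<^sub>R v + s *\<^sub>R w))
          - (f' (x + (z *\<^sub>R v + 0 *\<^sub>R w)) v - f' x v - L (z *\<^sub>R v + 0 *\<^sub>R w))"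
        unfolding \<phi>'_def by (simp add: L.add L.scaleR)
      then show ?thesis using est[of z s] est[of z 0] z s by linarith
    qed
    have "\<phi> s - \<phi> 0 - s\<^sup>2 * L w = s * (\<phi>' z - s * L w)"
      unfolding z(3) by (simp add: algebra_simps power2_eq_square)
    then have "\<bar>\<phi> s - \<phi> 0 - s\<^sup>2 * L w\<bar> \<le> s * (e * s)"
      using * s by (simp add: abs_mult)
    then show "\<bar>f (x + s *\<^sub>R v + s *\<^sub>R w) - f (x + s *\<^sub>R v) - f (x + s *\<^sub>R w) + f x - s\<^sup>2 * L w\<bar> \<le> e * s\<^sup>2"
      unfolding \<phi>_def by (simp add: algebra_simps power2_eq_square)
  qed
qed

text \<open>The mixed second difference is symmetric in v and w, and divided by s^2 it tends to
  \<open>Lv w\<close> as well as to \<open>Lw v\<close>.\<close>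

lemma symmetric_second_derivative:
  fixes f :: "'a::real_normed_vector \<Rightarrow> real"
  assumes S: "open S" "x \<in> S"
    and f: "\<And>y. y \<in> S \<Longrightarrow> (f has_derivative f' y) (at y)"
    and Lv: "((\<lambda>y. f' y v) has_derivative Lv) (at x)"
    and Lw: "((\<lambda>y. f' y w) has_derivative Lw) (at x)"
  shows "Lv w = Lw v"
proof (rule ccontr)
  assume "Lv w \<noteq> Lw v"
  \<comment> \<open>The two estimates allow a gap of at most 2 * e, so a third of the gap is small
    enough for a contradiction.\<close>
  define e where "e = \<bar>Lv w - Lw v\<bar> / 3"
  have e: "e > 0" using \<open>Lv w \<noteq> Lw v\<close> unfolding e_def by simp
  obtain d where d: "d > 0" "\<And>s. 0 < s \<Longrightarrow> s < d \<Longrightarrow>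
    \<bar>f (x + s *\<^sub>R v + s *\<^sub>R w) - f (x + s *\<^sub>R v) - f (x + s *\<^sub>R w) + f x - s\<^sup>2 * Lv w\<bar> \<le> e * s\<^sup>2"
    using second_difference_quotient[OF S f Lv e] by blast
  obtain d' where d': "d' > 0" "\<And>s. 0 < s \<Longrightarrow> s < d' \<Longrightarrow>
    \<bar>f (x + s *\<^sub>R w + s *\<^sub>R v) - f (x + s *\<^sub>R w) - f (x + s *\<^sub>R v) + f x - s\<^sup>2 * Lw v\<bar> \<le> e * s\<^sup>2"
    using second_difference_quotient[OF S f Lw e] by blast
  define s where "s = min d d' / 2"
  have s: "0 < s" "s < d" "s < d'" using d(1) d'(1) unfolding s_def by auto
  have "\<bar>s\<^sup>2 * Lv w - s\<^sup>2 * Lw v\<bar> \<le> 2 * (e * s\<^sup>2)"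
    using d(2)[OF s(1,2)] d'(2)[OF s(1,3)] by (simp add: add_ac)
  then have "s\<^sup>2 * \<bar>Lv w - Lw v\<bar> \<le> s\<^sup>2 * (2 * e)"
    by (simp add: abs_mult flip: right_diff_distrib) (simp add: mult_ac)
  then have "\<bar>Lv w - Lw v\<bar> \<le> 2 * e" using s by simp
  then show False using e unfolding e_def by simp
qed

section \<open>Orthonormal frames and principal directions\<close>

text \<open>Three orthonormal vectors span the space by counting dimensions, so the residue
  \<open>z\<close>, orthogonal to each of them, is orthogonal to itself.\<close>

lemma orthonormal_expansion3:
  fixes E1 E2 E3 x :: "real^3"
  assumes "E1 \<bullet> E1 = 1" "E2 \<bullet> E2 = 1" "E3 \<bullet> E3 = 1" "E1 \<bullet> E2 = 0" "E1 \<bullet> E3 = 0" "E2 \<bullet> E3 = 0"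
  shows "x = (x \<bullet> E1) *\<^sub>R E1 + (x \<bullet> E2) *\<^sub>R E2 + (x \<bullet> E3) *\<^sub>R E3"
proof -
  have ne: "E1 \<noteq> 0" "E2 \<noteq> 0" "E3 \<noteq> 0" "E1 \<noteq> E2" "E1 \<noteq> E3" "E2 \<noteq> E3" using assms by auto
  have "pairwise orthogonal {E1, E2, E3}"
    using assms by (auto simp: pairwise_insert orthogonal_def inner_commute)
  then have "independent {E1, E2, E3}" using ne by (intro pairwise_orthogonal_independent) auto
  then have "UNIV \<subseteq> span {E1, E2, E3}"
    using ne by (intro card_ge_dim_independent) auto
  then have sp: "y \<in> span {E1, E2, E3}" for y by auto
  define z where "z = x - ((x \<bullet> E1) *\<^sub>R E1 + (x \<bullet> E2) *\<^sub>R E2 + (x \<bullet> E3) *\<^sub>R E3)"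
  have "E2 \<bullet> E1 = 0" "E3 \<bullet> E1 = 0" "E3 \<bullet> E2 = 0"
    using assms(4-6) by (simp_all add: inner_commute)
  then have "orthogonal z y" if "y \<in> {E1, E2, E3}" for y
    using that assms
    by (auto simp: orthogonal_def z_def inner_diff_left inner_add_left)
  then have "orthogonal z z" using orthogonal_to_span[OF sp[of z], of z] by blast
  then show ?thesis unfolding z_def by (simp add: orthogonal_def)
qed

lemma plane_expansion:
  fixes e1 e2 v :: "real^2"
  assumes "\<And>\<alpha> \<beta>. \<alpha> *\<^sub>R e1 + \<beta> *\<^sub>R e2 = 0 \<Longrightarrow> \<alpha> = 0 \<and> \<beta> = 0"
  obtains \<alpha> \<beta> where "v = \<alpha> *\<^sub>R e1 + \<beta> *\<^sub>R e2"
proof -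
  have ne: "e1 \<noteq> 0" "e2 \<noteq> 0" "e1 \<noteq> e2"
    using assms[of 1 0] assms[of 0 1] assms[of 1 "-1"] by auto
  have "e2 \<noteq> c *\<^sub>R e1" for c using assms[of "-c" 1] by auto
  then have "independent {e2, e1}"
    using ne by (auto simp: independent_insert span_singleton)
  then have "UNIV \<subseteq> span {e2, e1}"
    using ne by (intro card_ge_dim_independent) auto
  then have "v \<in> span {e2, e1}" by auto
  then obtain \<beta> \<alpha> where "v - \<beta> *\<^sub>R e2 = \<alpha> *\<^sub>R e1"
    by (auto simp: span_insert span_singleton)
  then have "v = \<alpha> *\<^sub>R e1 + \<beta> *\<^sub>R e2" by (simp add: algebra_simps)
  then show ?thesis by (rule that)
qed

text \<open>The vanishing expression is the off-diagonal entry, in the basis (x, y), (-y, x), of the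
  symmetric matrix with rows (p, q) and (q, s). Half the polar angle of ((p - s) / 2, q) is the
  right rotation; umbilics need no separate case.\<close>

lemma rotation_diagonalizes:
  fixes p q s :: real
  obtains x y where "x\<^sup>2 + y\<^sup>2 = 1" "(x\<^sup>2 - y\<^sup>2) * q + x * y * (s - p) = 0"
proof -
  obtain \<rho> \<phi> where 1: "(p - s) / 2 = \<rho> * cos \<phi>" "q = \<rho> * sin \<phi>" using polar_Ex by blast
  define x y where "x = cos (\<phi> / 2)" and "y = sin (\<phi> / 2)"
  have c: "cos \<phi> = x\<^sup>2 - y\<^sup>2" and s: "sin \<phi> = 2 * x * y"
    using cos_double[of "\<phi>/2"] sin_double[of "\<phi>/2"] by (simp_all add: x_def y_def)
  have sp: "s - p = - 2 * (\<rho> * (x\<^sup>2 - y\<^sup>2))" using 1(1) c by simp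
  have "(x\<^sup>2 - y\<^sup>2) * q + x * y * (s - p) = 0"
    unfolding 1(2) s sp by (simp add: algebra_simps)
  then show ?thesis using that[of x y] by (simp add: x_def y_def)
qed

text \<open>Rodrigues' formula. Gram-Schmidt for the metric pulled back by \<open>T\<close> gives an
  orthonormal frame, and a rotation diagonalizes the symmetric form
  \<open>T v \<bullet> N w\<close>. As the values of \<open>N\<close> are orthogonal to
  \<open>m\<close>, only the component of \<open>N e1\<close> along \<open>T e1\<close> survives,
  and likewise for \<open>e2\<close>.\<close>

lemma principal_frame:
  fixes T N :: "real^2 \<Rightarrow> real^3" and m :: "real^3"
  assumes lin: "linear T" "linear N" and inj: "inj T"
    and m: "m \<bullet> m = 1" "\<And>v. T v \<bullet> m = 0" "\<And>v. N v \<bullet> m = 0"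
    and sym: "\<And>v w. T v \<bullet> N w = T w \<bullet> N v"
  obtains e1 e2 \<kappa>1 \<kappa>2 where "T e1 \<bullet> T e1 = 1" "T e2 \<bullet> T e2 = 1" "T e1 \<bullet> T e2 = 0"
    "N e1 = - \<kappa>1 *\<^sub>R T e1" "N e2 = - \<kappa>2 *\<^sub>R T e2"
proof -
  interpret T: linear T by fact
  interpret N: linear N by fact
  define f1 :: "real^2" where "f1 = axis 1 1"
  define f2 :: "real^2" where "f2 = axis 2 1"
  have T0: "T v = 0 \<longleftrightarrow> v = 0" for v using inj T.zero by (metis injD)
  have ind: "\<alpha> *\<^sub>R f1 + \<beta> *\<^sub>R f2 = 0 \<Longrightarrow> \<alpha> = 0 \<and> \<beta> = 0" for \<alpha> \<beta>
    by (auto simp: f1_def f2_def vec_eq_iff axis_def forall_2)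
  define g1 where "g1 = f1 /\<^sub>R norm (T f1)"
  define h where "h = f2 - (T f2 \<bullet> T g1) *\<^sub>R g1"
  define g2 where "g2 = h /\<^sub>R norm (T h)"
  have f1: "norm (T f1) \<noteq> 0" using ind[of 1 0] T0 by auto
  have g1: "T g1 \<bullet> T g1 = 1"
    using f1 by (simp add: g1_def T.scaleR dot_square_norm power2_eq_square)
  have "h \<noteq> 0" using ind[of "- (T f2 \<bullet> T g1) / norm (T f1)" 1]
    by (auto simp: h_def g1_def divide_inverse)
  then have h: "norm (T h) \<noteq> 0" using T0 by simp
  have g2: "T g2 \<bullet> T g2 = 1"
    using h by (simp add: g2_def T.scaleR dot_square_norm power2_eq_square)
  have "T h \<bullet> T g1 = 0" using g1 by (simp add: h_def T.diff T.scaleR inner_diff_left)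
  then have g12: "T g1 \<bullet> T g2 = 0" by (simp add: g2_def T.scaleR inner_commute)
  define p q s where "p = T g1 \<bullet> N g1" and "q = T g1 \<bullet> N g2" and "s = T g2 \<bullet> N g2"
  have q': "T g2 \<bullet> N g1 = q" unfolding q_def by (rule sym)
  obtain x y where xy: "x\<^sup>2 + y\<^sup>2 = 1" "(x\<^sup>2 - y\<^sup>2) * q + x * y * (s - p) = 0"
    by (rule rotation_diagonalizes)
  define e1 where "e1 = x *\<^sub>R g1 + y *\<^sub>R g2"
  define e2 where "e2 = (-y) *\<^sub>R g1 + x *\<^sub>R g2"
  note ex = e1_def e2_def T.add T.scaleR N.add N.scaleR inner_add_left inner_add_right
    inner_scaleR_left inner_scaleR_right g1 g2 g12 inner_commute[of "T g2" "T g1"]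
  have E: "T e1 \<bullet> T e1 = 1" "T e2 \<bullet> T e2 = 1" "T e1 \<bullet> T e2 = 0"
    using xy(1) by (simp_all only: ex) (simp_all add: algebra_simps power2_eq_square)
  have "T e1 \<bullet> N e2 = (x\<^sup>2 - y\<^sup>2) * q + x * y * (s - p)"
    by (simp only: ex q' p_def[symmetric] q_def[symmetric] s_def[symmetric])
       (simp add: algebra_simps power2_eq_square)
  then have o: "N e2 \<bullet> T e1 = 0" using xy(2) by (simp add: inner_commute)
  then have o': "N e1 \<bullet> T e2 = 0" using sym[of e1 e2] by (simp add: inner_commute)
  note rep = orthonormal_expansion3[OF E(1,2) m(1) E(3) m(2) m(2)]
  have "N e1 = - (- (N e1 \<bullet> T e1)) *\<^sub>R T e1" using rep[of "N e1"] m(3) o' by simp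
  moreover have "N e2 = - (- (N e2 \<bullet> T e2)) *\<^sub>R T e2" using rep[of "N e2"] m(3) o by simp
  ultimately show ?thesis using that E by blast
qed

section \<open>Nullity of 2x2 matrices and the discriminant of M\<close>

text \<open>In the singular nonzero case the kernel is the line orthogonal to a nonzero row, hence
  spanned by that row turned through a right angle.\<close>

lemma dim_kernel_2x2:
  fixes m11 m12 m21 m22 :: real
  shows "dim {(\<alpha>, \<beta>). m11 * \<alpha> + m12 * \<beta> = 0 \<and> m21 * \<alpha> + m22 * \<beta> = 0} =
    (if m11 * m22 - m12 * m21 \<noteq> 0 then 0
     else if m11 = 0 \<and> m12 = 0 \<and> m21 = 0 \<and> m22 = 0 then 2 else 1)" (is "dim ?S = _")
proof (cases "m11 * m22 - m12 * m21 = 0")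
  case False
  have "?S \<subseteq> {0}"
  proof
    fix x assume "x \<in> ?S"
    then obtain \<alpha> \<beta> where x: "x = (\<alpha>, \<beta>)"
      and z: "m11 * \<alpha> + m12 * \<beta> = 0" "m21 * \<alpha> + m22 * \<beta> = 0" by blast
    \<comment> \<open>Cramer's rule: the adjugate applied to the two equations.\<close>
    have *: "(m11 * m22 - m12 * m21) * \<alpha> = m22 * (m11 * \<alpha> + m12 * \<beta>) - m12 * (m21 * \<alpha> + m22 * \<beta>)"
      "(m11 * m22 - m12 * m21) * \<beta> = m11 * (m21 * \<alpha> + m22 * \<beta>) - m21 * (m11 * \<alpha> + m12 * \<beta>)"
      by (simp_all add: algebra_simps)
    have "(m11 * m22 - m12 * m21) * \<alpha> = 0" "(m11 * m22 - m12 * m21) * \<beta> = 0"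
      by (simp_all only: * z mult_zero_right diff_zero)
    then have "\<alpha> = 0" "\<beta> = 0" using False by (simp_all only: mult_eq_0_iff simp_thms)
    then show "x \<in> {0}" by (simp add: x zero_prod_def)
  qed
  then show ?thesis using False dim_eq_0[of ?S] by simp
next
  case True
  show ?thesis
  proof (cases "m11 = 0 \<and> m12 = 0 \<and> m21 = 0 \<and> m22 = 0")
    case z: True
    then have "?S = UNIV" by auto
    then show ?thesis using z by (simp add: DIM_prod)
  next
    case nz: False
    obtain a b where ab: "(a, b) \<noteq> (0, 0)" "?S = span {(a, b)}"
    proof (cases "m11 = 0 \<and> m12 = 0")
      case z: True
      have "?S = range (\<lambda>k. k *\<^sub>R (m22, - m21))"
      proof (intro set_eqI iffI)
        fix x assume "x \<in> ?S"
        then obtain \<alpha> \<beta> where x: "x = (\<alpha>, \<beta>)" "m21 * \<alpha> + m22 * \<beta> = 0" by auto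
        show "x \<in> range (\<lambda>k. k *\<^sub>R (m22, - m21))"
        proof (cases "m22 = 0")
          case True
          then show ?thesis using x nz z by (intro range_eqI[of _ _ "- \<beta> / m21"]) auto
        next
          case False
          then show ?thesis using x by (intro range_eqI[of _ _ "\<alpha> / m22"]) (auto simp: field_simps)
        qed
      qed (use z in \<open>auto simp: algebra_simps\<close>)
      then show ?thesis using that[of m22 "- m21"] nz z by (auto simp: span_singleton)
    next
      case z: False
      have "?S = range (\<lambda>k. k *\<^sub>R (m12, - m11))"
      proof (intro set_eqI iffI)
        fix x assume "x \<in> ?S"
        then obtain \<alpha> \<beta> where x: "x = (\<alpha>, \<beta>)" "m11 * \<alpha> + m12 * \<beta> = 0" by auto
        show "x \<in> range (\<lambda>k. k *\<^sub>R (m12, - m11))"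
        proof (cases "m12 = 0")
          case True
          then show ?thesis using x z by (intro range_eqI[of _ _ "- \<beta> / m11"]) auto
        next
          case False
          then show ?thesis using x by (intro range_eqI[of _ _ "\<alpha> / m12"]) (auto simp: field_simps)
        qed
      qed (use True in \<open>auto simp: algebra_simps\<close>)
      then show ?thesis using that[of m12 "- m11"] z by (auto simp: span_singleton)
    qed
    then have "dim ?S = 1" using dim_eq_card_independent[of "{(a, b)}"] by (simp add: zero_prod_def)
    then show ?thesis using True nz by simp
  qed
qed

lemma card_index_2: "card {i::2. P i} = of_bool (P 1) + of_bool (P 2)"
proof -
  have "{i::2. P i} = (if P 1 then {1} else {}) \<union> (if P 2 then {2} else {})"
    by (auto simp: forall_2 set_eq_iff)
  then show ?thesis by auto
qed

text \<open>This is 4 det M <= (tr M)^2 for w = (p, q) in the principal frame.\<close>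

lemma reflection_discriminant_nonneg:
  fixes \<kappa>1 \<kappa>2 p q :: real
  shows "4 * \<kappa>1 * \<kappa>2 * (1 + p\<^sup>2 + q\<^sup>2) \<le> (\<kappa>1 * (1 + p\<^sup>2) + \<kappa>2 * (1 + q\<^sup>2))\<^sup>2"
proof (cases "\<kappa>1 * \<kappa>2 \<ge> 0")
  case True
  have "(\<kappa>1 * (1 + p\<^sup>2) + \<kappa>2 * (1 + q\<^sup>2))\<^sup>2 - 4 * \<kappa>1 * \<kappa>2 * (1 + p\<^sup>2 + q\<^sup>2)
     = (\<kappa>1 * (1 + p\<^sup>2) - \<kappa>2 * (1 + q\<^sup>2))\<^sup>2 + 4 * (\<kappa>1 * \<kappa>2) * (p * q)\<^sup>2"
    by (simp add: algebra_simps power2_eq_square)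
  also have "\<dots> \<ge> 0" using True by simp
  finally show ?thesis by simp
next
  case False
  have "0 \<le> 1 + p\<^sup>2 + q\<^sup>2" by (simp add: add_nonneg_nonneg)
  then have "(\<kappa>1 * \<kappa>2) * (1 + p\<^sup>2 + q\<^sup>2) \<le> 0" using False by (simp add: mult_nonpos_nonneg)
  then have "4 * \<kappa>1 * \<kappa>2 * (1 + p\<^sup>2 + q\<^sup>2) \<le> 0" by simp
  then show ?thesis by (meson order_trans zero_le_power2)
qed

text \<open>The equality case, with the conclusion that M is scalar. Equal diagonal entries force
  \<kappa>1 and \<kappa>2 to vanish together, so the vanishing of \<kappa>1 \<kappa>2 (p q)^2 means
  that p q = 0 or both curvatures are 0; either way the off-diagonal entries vanish.\<close>

lemma reflection_discriminant_zero:
  fixes \<kappa>1 \<kappa>2 p q :: real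
  assumes nonneg: "\<kappa>1 * \<kappa>2 \<ge> 0"
    and eq: "(\<kappa>1 * (1 + p\<^sup>2) + \<kappa>2 * (1 + q\<^sup>2))\<^sup>2 = 4 * \<kappa>1 * \<kappa>2 * (1 + p\<^sup>2 + q\<^sup>2)"
  shows "\<kappa>1 * (1 + p\<^sup>2) = \<kappa>2 * (1 + q\<^sup>2)" "\<kappa>1 * (p * q) = 0" "\<kappa>2 * (p * q) = 0"
proof -
  have "(\<kappa>1 * (1 + p\<^sup>2) - \<kappa>2 * (1 + q\<^sup>2))\<^sup>2 + 4 * (\<kappa>1 * \<kappa>2) * (p * q)\<^sup>2 = 0"
    using eq by (simp add: algebra_simps power2_eq_square)
  moreover have "(\<kappa>1 * \<kappa>2) * (p * q)\<^sup>2 \<ge> 0" using nonneg by simp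
  ultimately have z: "(\<kappa>1 * (1 + p\<^sup>2) - \<kappa>2 * (1 + q\<^sup>2))\<^sup>2 = 0" "(\<kappa>1 * \<kappa>2) * (p * q)\<^sup>2 = 0"
    using zero_le_power2[of "\<kappa>1 * (1 + p\<^sup>2) - \<kappa>2 * (1 + q\<^sup>2)"] by linarith+
  show eq: "\<kappa>1 * (1 + p\<^sup>2) = \<kappa>2 * (1 + q\<^sup>2)" using z(1) by simp
  have "1 + p\<^sup>2 \<noteq> 0" "1 + q\<^sup>2 \<noteq> 0" by (smt (verit) zero_le_power2)+
  then have "\<kappa>1 = 0 \<longleftrightarrow> \<kappa>2 = 0" using eq by (metis mult_eq_0_iff)
  then show "\<kappa>1 * (p * q) = 0" "\<kappa>2 * (p * q) = 0" using z(2) by auto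
qed

section \<open>The surface at one point, in a principal frame\<close>

lemma linear_axis_expansion:
  fixes f :: "real^2 \<Rightarrow> 'a::real_vector"
  assumes "linear f"
  shows "f v = v$1 *\<^sub>R f (axis 1 1) + v$2 *\<^sub>R f (axis 2 1)"
proof -
  have "v = v$1 *\<^sub>R axis 1 1 + v$2 *\<^sub>R axis 2 1" by (simp add: vec_eq_iff forall_2 axis_def)
  then show ?thesis using linear_add[OF assms] linear_scale[OF assms] by metis
qed

lemma inner_plane: "v \<bullet> w = v$1 * w$1 + v$2 * w$2" for v w :: "real^2"
  by (simp add: inner_vec_def sum_2)

text \<open>Data at a single point: \<open>T\<close> and \<open>N\<close> are the differentials of
  \<open>r\<close> and \<open>n\<close>, and \<open>T e1\<close>, \<open>T e2\<close>,
  \<open>n u\<close> form an orthonormal basis of space in which the shape operator is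
  diagonal.\<close>

locale reflection_frame =
  fixes r n :: "real^2 \<Rightarrow> real^3" and u :: "real^2" and T N :: "real^2 \<Rightarrow> real^3"
    and e1 e2 :: "real^2" and \<kappa>1 \<kappa>2 :: real
  assumes r': "(r has_derivative T) (at u)" and n': "(n has_derivative N) (at u)"
    and inj: "inj T"
    and nn: "n u \<bullet> n u = 1" and Tn: "\<And>v. T v \<bullet> n u = 0" and Nn: "\<And>v. N v \<bullet> n u = 0"
    and E: "T e1 \<bullet> T e1 = 1" "T e2 \<bullet> T e2 = 1" "T e1 \<bullet> T e2 = 0"
    and Ne: "N e1 = - \<kappa>1 *\<^sub>R T e1" "N e2 = - \<kappa>2 *\<^sub>R T e2"
    and r0: "r u \<noteq> 0" and cneg: "incident_dir r u \<bullet> n u < 0"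
begin

sublocale T: linear T using r' by (rule has_derivative_linear)
sublocale N: linear N using n' by (rule has_derivative_linear)

definition "\<rho> = norm (r u)"
definition "c = cos_incidence r n u"
definition "a1 = incident_dir r u \<bullet> T e1"
definition "a2 = incident_dir r u \<bullet> T e2"

lemma \<rho>_pos: "\<rho> > 0" using r0 by (simp add: \<rho>_def)

lemma c_neg: "c < 0" using cneg by (simp add: c_def cos_incidence_def)

lemma E': "T e2 \<bullet> T e1 = 0" "n u \<bullet> T v = 0" "n u \<bullet> N v = 0"
  using E(3) Tn Nn by (simp_all add: inner_commute)

lemma expand: "x = (x \<bullet> T e1) *\<^sub>R T e1 + (x \<bullet> T e2) *\<^sub>R T e2 + (x \<bullet> n u) *\<^sub>R n u"
  by (rule orthonormal_expansion3) (simp_all add: E E' nn Tn)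

lemma eq_iff: "x = y \<longleftrightarrow> x \<bullet> T e1 = y \<bullet> T e1 \<and> x \<bullet> T e2 = y \<bullet> T e2 \<and> x \<bullet> n u = y \<bullet> n u"
  using expand[of x] expand[of y] by metis

lemma incident_expand: "incident_dir r u = a1 *\<^sub>R T e1 + a2 *\<^sub>R T e2 + c *\<^sub>R n u"
  unfolding a1_def a2_def c_def cos_incidence_def by (rule expand)

lemma incident_unit: "a1\<^sup>2 + a2\<^sup>2 + c\<^sup>2 = 1"
proof -
  have "incident_dir r u \<bullet> incident_dir r u = 1"
    using r0 by (simp add: incident_dir_def dot_square_norm power2_eq_square)
  then show ?thesis
    unfolding incident_expand by (simp add: inner_add_left inner_add_right E E' nn Tn power2_eq_square)
qed

lemma frame_ind: "\<alpha> *\<^sub>R e1 + \<beta> *\<^sub>R e2 = \<alpha>' *\<^sub>R e1 + \<beta>' *\<^sub>R e2 \<longleftrightarrow> \<alpha> = \<alpha>' \<and> \<beta> = \<beta>'"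
proof
  assume "\<alpha> *\<^sub>R e1 + \<beta> *\<^sub>R e2 = \<alpha>' *\<^sub>R e1 + \<beta>' *\<^sub>R e2"
  then have "T (\<alpha> *\<^sub>R e1 + \<beta> *\<^sub>R e2) = T (\<alpha>' *\<^sub>R e1 + \<beta>' *\<^sub>R e2)" by simp
  from arg_cong[OF this, of "\<lambda>x. x \<bullet> T e1"] arg_cong[OF this, of "\<lambda>x. x \<bullet> T e2"]
  show "\<alpha> = \<alpha>' \<and> \<beta> = \<beta>'" by (simp add: T.add T.scaleR inner_add_left E E')
qed auto

lemma frame_coords: obtains \<alpha> \<beta> where "v = \<alpha> *\<^sub>R e1 + \<beta> *\<^sub>R e2"
  by (rule plane_expansion[of e1 e2 v]) (use frame_ind[of _ _ 0 0] in auto)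

lemma frechet_r: "frechet_derivative r (at u) = T"
  using frechet_derivative_at[OF r'] by simp

lemma frechet_n: "frechet_derivative n (at u) = N"
  using frechet_derivative_at[OF n'] by simp

lemma first_form_apply: "v \<bullet> (first_form r u *v w) = T v \<bullet> T w"
  unfolding linear_axis_expansion[OF T.linear_axioms, of v] linear_axis_expansion[OF T.linear_axioms, of w]
  by (simp add: inner_plane matrix_vector_mult_def sum_2 first_form_def partial_deriv_def frechet_r
      inner_add_left inner_add_right algebra_simps inner_commute)

lemma second_form_apply: "v \<bullet> (second_form r n u *v w) = - (T v \<bullet> N w)"
  unfolding linear_axis_expansion[OF T.linear_axioms, of v] linear_axis_expansion[OF N.linear_axioms, of w]
  by (simp add: inner_plane matrix_vector_mult_def sum_2 second_form_def partial_deriv_def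
      frechet_r frechet_n inner_add_left inner_add_right algebra_simps inner_commute)

text \<open>Both sides are paired with vectors of the frame, which is orthonormal for the first form
  and diagonalizes the second.\<close>

lemma principal_curvature_iff:
  "second_form r n u *v (\<alpha> *\<^sub>R e1 + \<beta> *\<^sub>R e2) = k *\<^sub>R (first_form r u *v (\<alpha> *\<^sub>R e1 + \<beta> *\<^sub>R e2))
    \<longleftrightarrow> \<kappa>1 * \<alpha> = k * \<alpha> \<and> \<kappa>2 * \<beta> = k * \<beta>" (is "?l = ?r \<longleftrightarrow> _")
proof -
  have l: "(x *\<^sub>R e1 + y *\<^sub>R e2) \<bullet> ?l = x * (\<kappa>1 * \<alpha>) + y * (\<kappa>2 * \<beta>)" for x y
    unfolding second_form_apply
    by (simp add: T.add T.scaleR N.add N.scaleR Ne inner_add_left inner_diff_right E E')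
  have r: "(x *\<^sub>R e1 + y *\<^sub>R e2) \<bullet> ?r = x * (k * \<alpha>) + y * (k * \<beta>)" for x y
    unfolding inner_scaleR_right first_form_apply
    by (simp add: T.add T.scaleR inner_add_left inner_add_right E E' algebra_simps)
  show ?thesis
  proof
    assume "?l = ?r"
    then show "\<kappa>1 * \<alpha> = k * \<alpha> \<and> \<kappa>2 * \<beta> = k * \<beta>"
      using l[of 1 0] r[of 1 0] l[of 0 1] r[of 0 1] by simp
  next
    assume "\<kappa>1 * \<alpha> = k * \<alpha> \<and> \<kappa>2 * \<beta> = k * \<beta>"
    then have "v \<bullet> ?l = v \<bullet> ?r" for v
      by (rule_tac v = v in frame_coords) (simp only: l r)
    then show "?l = ?r" using vector_eq_ldot by blast
  qed
qed

lemma principal_curvatures_eq: "principal_curvatures r n u = {\<kappa>1, \<kappa>2}"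
proof (intro set_eqI iffI)
  fix k assume "k \<in> principal_curvatures r n u"
  then obtain v where v: "v \<noteq> 0" "second_form r n u *v v = k *\<^sub>R (first_form r u *v v)"
    unfolding principal_curvatures_def by auto
  obtain \<alpha> \<beta> where ab: "v = \<alpha> *\<^sub>R e1 + \<beta> *\<^sub>R e2" by (rule frame_coords)
  then show "k \<in> {\<kappa>1, \<kappa>2}" using v by (auto simp: principal_curvature_iff)
next
  fix k assume k: "k \<in> {\<kappa>1, \<kappa>2}"
  have "second_form r n u *v e1 = \<kappa>1 *\<^sub>R (first_form r u *v e1)"
    "second_form r n u *v e2 = \<kappa>2 *\<^sub>R (first_form r u *v e2)" "e1 \<noteq> 0" "e2 \<noteq> 0"
    using principal_curvature_iff[of 1 0 \<kappa>1] principal_curvature_iff[of 0 1 \<kappa>2]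
      frame_ind[of 1 0 0 0] frame_ind[of 0 1 0 0] by auto
  then show "k \<in> principal_curvatures r n u"
    using k unfolding principal_curvatures_def by auto
qed

lemma mean_curvature_eq: "2 * mean_curvature r n u = \<kappa>1 + \<kappa>2"
  by (simp add: mean_curvature_def principal_curvatures_eq min_def max_def)

lemma gauss_curvature_eq: "gauss_curvature r n u = \<kappa>1 * \<kappa>2"
  by (simp add: gauss_curvature_def principal_curvatures_eq min_def max_def)

lemma tangent_coords_incident:
  "tangent_coords r u (incident_tangent r n u) = a1 *\<^sub>R e1 + a2 *\<^sub>R e2"
proof -
  have *: "incident_tangent r n u = T (a1 *\<^sub>R e1 + a2 *\<^sub>R e2)"
    unfolding incident_tangent_def cos_incidence_def[symmetric] c_def[symmetric] incident_expand
    by (simp add: incident_expand[symmetric] T.add T.scaleR)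
       (simp add: incident_expand inner_add_left nn Tn)
  show ?thesis unfolding tangent_coords_def frechet_r * by (rule the_equality) (use inj in \<open>auto dest: injD\<close>)
qed

text \<open>Euler's formula gives the normal curvature with denominator |a_t|^2, which cancels
  against tan^2(theta) = |a_t|^2 / c^2.\<close>

lemma normal_curvature_tan2:
  "normal_curvature r n u (incident_tangent r n u) * tan2_incidence r n u
    = \<kappa>1 * (a1 / c)\<^sup>2 + \<kappa>2 * (a2 / c)\<^sup>2"
proof -
  have k: "normal_curvature r n u (incident_tangent r n u)
    = (\<kappa>1 * a1\<^sup>2 + \<kappa>2 * a2\<^sup>2) / (a1\<^sup>2 + a2\<^sup>2)"
    unfolding normal_curvature_def tangent_coords_incident Let_def first_form_apply second_form_apply
    by (simp add: T.add T.scaleR N.add N.scaleR Ne inner_add_left inner_add_right E E'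
        power2_eq_square algebra_simps)
  have t: "tan2_incidence r n u = (a1\<^sup>2 + a2\<^sup>2) / c\<^sup>2"
    unfolding tan2_incidence_def c_def[symmetric] using incident_unit by (simp add: algebra_simps)
  show ?thesis
  proof (cases "a1\<^sup>2 + a2\<^sup>2 = 0")
    \<comment> \<open>Normal incidence: there is no tangential direction, but
      \<open>tan2_incidence\<close> is 0 and so is the right-hand side.\<close>
    case True
    then have "a1 = 0" "a2 = 0" by (simp_all add: sum_power2_eq_zero_iff)
    then show ?thesis by (simp add: k t)
  next
    case False
    then have *: "X / (a1\<^sup>2 + a2\<^sup>2) * ((a1\<^sup>2 + a2\<^sup>2) / c\<^sup>2) = X / c\<^sup>2" for X by simp
    show ?thesis unfolding k t * by (simp add: power_divide add_divide_distrib)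
  qed
qed

section \<open>The reflection quadratic\<close>

text \<open>The trace of M in the principal frame.\<close>

definition "tr = \<kappa>1 * (1 + (a1 / c)\<^sup>2) + \<kappa>2 * (1 + (a2 / c)\<^sup>2)"

lemma reflection_poly_eq:
  "reflection_poly r n u = [:(1 / \<rho>)\<^sup>2 + 2 * c * tr / \<rho> + 4 * (\<kappa>1 * \<kappa>2), 2 / \<rho> + 2 * c * tr, 1:]"
proof -
  have "2 * mean_curvature r n u + normal_curvature r n u (incident_tangent r n u) * tan2_incidence r n u = tr"
    unfolding mean_curvature_eq normal_curvature_tan2 tr_def by (simp add: algebra_simps)
  then show ?thesis
    unfolding reflection_poly_def \<rho>_def[symmetric] c_def[symmetric] gauss_curvature_eq
    by (simp add: power2_eq_square)
qed

text \<open>Vieta's relations; through them multiplicities are later counted without a formula for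
  the roots.\<close>

lemma factors_iff:
  "reflection_poly r n u = [:- k1, 1:] * [:- k2, 1:] \<longleftrightarrow>
    k1 + k2 = - (2 / \<rho> + 2 * c * tr) \<and> k1 * k2 = (1 / \<rho>)\<^sup>2 + 2 * c * tr / \<rho> + 4 * (\<kappa>1 * \<kappa>2)"
  unfolding reflection_poly_eq by (auto simp: algebra_simps)

text \<open>The incident direction is a unit vector. In this form the identity turns c^2 det M into
  K, which is why the constant term of the quadratic is 4K without a factor of cos(theta).\<close>

lemma c_unit: "c\<^sup>2 * (1 + (a1 / c)\<^sup>2 + (a2 / c)\<^sup>2) = 1"
  using incident_unit c_neg by (simp add: power_divide distrib_left add_ac)

lemma reflection_poly_splits: obtains k1 k2 where "reflection_poly r n u = [:- k1, 1:] * [:- k2, 1:]"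
proof -
  \<comment> \<open>A quarter of the discriminant of the quadratic in the unknown k* +
    1/\<rho>.\<close>
  define d where "d = (c * tr)\<^sup>2 - 4 * (\<kappa>1 * \<kappa>2)"
  have "c\<^sup>2 * (4 * \<kappa>1 * \<kappa>2 * (1 + (a1 / c)\<^sup>2 + (a2 / c)\<^sup>2)) \<le> c\<^sup>2 * tr\<^sup>2"
    unfolding tr_def by (intro mult_left_mono reflection_discriminant_nonneg) simp
  also have "c\<^sup>2 * (4 * \<kappa>1 * \<kappa>2 * (1 + (a1 / c)\<^sup>2 + (a2 / c)\<^sup>2)) = 4 * (\<kappa>1 * \<kappa>2)"
    using c_unit by (metis (no_types, lifting) mult.assoc mult.left_commute mult.right_neutral)
  finally have d: "d \<ge> 0" unfolding d_def by (simp add: power_mult_distrib)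
  have "reflection_poly r n u = [:- (- (1 / \<rho> + c * tr) + sqrt d), 1:] * [:- (- (1 / \<rho> + c * tr) - sqrt d), 1:]"
    unfolding factors_iff
  proof
    have "(- (1 / \<rho> + c * tr) + sqrt d) * (- (1 / \<rho> + c * tr) - sqrt d) = (1 / \<rho> + c * tr)\<^sup>2 - (sqrt d)\<^sup>2"
      by (simp add: algebra_simps power2_eq_square)
    then show "(- (1 / \<rho> + c * tr) + sqrt d) * (- (1 / \<rho> + c * tr) - sqrt d)
      = (1 / \<rho>)\<^sup>2 + 2 * c * tr / \<rho> + 4 * (\<kappa>1 * \<kappa>2)"
      using d by (simp add: d_def power2_sum)
  qed simp
  then show ?thesis by (rule that)
qed

section \<open>Differential of the ray map and its kernel\<close>

text \<open>The product rule for b = a - 2 (a, n) n. The differential of a = r / |r| is the part of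
  \<open>T v\<close> orthogonal to the incident ray, divided by the distance from the
  source.\<close>

definition "reflected_deriv v = (1 / \<rho>) *\<^sub>R (T v - (incident_dir r u \<bullet> T v) *\<^sub>R incident_dir r u)
   - (2 * ((1 / \<rho>) *\<^sub>R (T v - (incident_dir r u \<bullet> T v) *\<^sub>R incident_dir r u) \<bullet> n u
       + incident_dir r u \<bullet> N v)) *\<^sub>R n u - (2 * c) *\<^sub>R N v"

lemma incident_dir_derivative: "(incident_dir r has_derivative
    (\<lambda>v. (1 / \<rho>) *\<^sub>R (T v - (incident_dir r u \<bullet> T v) *\<^sub>R incident_dir r u))) (at u)"
proof -
  have nr: "((\<lambda>u. norm (r u)) has_derivative (\<lambda>v. T v \<bullet> sgn (r u))) (at u)"
    using has_derivative_compose[OF r' has_derivative_norm[OF r0]] by simp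
  have "((\<lambda>u. r u /\<^sub>R norm (r u)) has_derivative
     (\<lambda>v. (- (inverse \<rho> * (T v \<bullet> sgn (r u)) * inverse \<rho>)) *\<^sub>R r u + inverse \<rho> *\<^sub>R T v)) (at u)"
    unfolding \<rho>_def by (rule derivative_eq_intros nr r' refl | use r0 in simp)+
  then show ?thesis
    unfolding incident_dir_def[abs_def]
    by (rule has_derivative_eq_rhs)
       (auto simp: \<rho>_def sgn_div_norm fun_eq_iff divide_inverse algebra_simps inner_commute)
qed

lemma reflected_dir_derivative: "(reflected_dir r n has_derivative reflected_deriv) (at u)"
  unfolding reflected_dir_def[abs_def]
  by (rule derivative_eq_intros incident_dir_derivative n' refl)+
     (simp add: fun_eq_iff reflected_deriv_def c_def cos_incidence_def algebra_simps)

lemma ray_map_has_derivative: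
  "(ray_map r (reflected_dir r n) has_derivative
     (\<lambda>(v, s). T v + t *\<^sub>R reflected_deriv v + s *\<^sub>R reflected_dir r n u)) (at (u, t))"
proof -
  have f: "((\<lambda>x. r (fst x)) has_derivative (\<lambda>x. T (fst x))) (at (u, t))"
    "((\<lambda>x. reflected_dir r n (fst x)) has_derivative (\<lambda>x. reflected_deriv (fst x))) (at (u, t))"
    using has_derivative_compose[OF has_derivative_fst[OF has_derivative_ident], of r T]
      has_derivative_compose[OF has_derivative_fst[OF has_derivative_ident], of "reflected_dir r n" reflected_deriv]
      r' reflected_dir_derivative by auto
  have "((\<lambda>x. r (fst x) + snd x *\<^sub>R reflected_dir r n (fst x)) has_derivative
     (\<lambda>(v, s). T v + t *\<^sub>R reflected_deriv v + s *\<^sub>R reflected_dir r n u)) (at (u, t))"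
    by (rule derivative_eq_intros f refl)+ (auto simp: fun_eq_iff)
  then show ?thesis by (simp add: ray_map_def case_prod_unfold)
qed

lemma ray_map_derivative:
  "frechet_derivative (ray_map r (reflected_dir r n)) (at (u, t))
    = (\<lambda>(v, s). T v + t *\<^sub>R reflected_deriv v + s *\<^sub>R reflected_dir r n u)"
  by (rule frechet_derivative_at[symmetric]) (rule ray_map_has_derivative)

text \<open>Composing the differential of the ray map with the reflection in the tangent plane and then
  with the projection along the incident ray onto the tangent plane gives
  \<open>(1 + t/\<rho>) I + 2 t c (I + w w\<^sup>T) S\<close>, where \<open>w = a\<^sub>t / c\<close> and \<open>S\<close> is the shape operator.
  Its matrix in the frame is \<open>m11, m12, m21, m22\<close>, and \<open>ray_coeff\<close> recovers the coordinate along
  the reflected ray.\<close>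

definition "m11 t = 1 + t / \<rho> + 2 * c * t * (\<kappa>1 * (1 + (a1 / c)\<^sup>2))"
definition "m12 t = 2 * c * t * (\<kappa>2 * ((a1 / c) * (a2 / c)))"
definition "m21 t = 2 * c * t * (\<kappa>1 * ((a1 / c) * (a2 / c)))"
definition "m22 t = 1 + t / \<rho> + 2 * c * t * (\<kappa>2 * (1 + (a2 / c)\<^sup>2))"
definition "ray_coeff t \<alpha> \<beta> = t * ((a1 * \<alpha> + a2 * \<beta>) / \<rho> + 2 * (a1 * \<kappa>1 * \<alpha> + a2 * \<kappa>2 * \<beta>) / c)"

text \<open>The equation is split along \<open>T e1\<close>, \<open>T e2\<close> and
  \<open>n u\<close>. The normal component contains s with the coefficient -c, so it determines s;
  inserting this value into the tangential components yields the 2x2 system.\<close>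

lemma ray_map_kernel_iff:
  "T (\<alpha> *\<^sub>R e1 + \<beta> *\<^sub>R e2) + t *\<^sub>R reflected_deriv (\<alpha> *\<^sub>R e1 + \<beta> *\<^sub>R e2) + s *\<^sub>R reflected_dir r n u = 0 \<longleftrightarrow>
    m11 t * \<alpha> + m12 t * \<beta> = 0 \<and> m21 t * \<alpha> + m22 t * \<beta> = 0 \<and> s = ray_coeff t \<alpha> \<beta>"
proof -
  define m where "m = a1 * \<alpha> + a2 * \<beta>"
  define q where "q = a1 * \<kappa>1 * \<alpha> + a2 * \<kappa>2 * \<beta>"
  have Tv: "T (\<alpha> *\<^sub>R e1 + \<beta> *\<^sub>R e2) = \<alpha> *\<^sub>R T e1 + \<beta> *\<^sub>R T e2" by (simp add: T.add T.scaleR)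
  have Nv: "N (\<alpha> *\<^sub>R e1 + \<beta> *\<^sub>R e2) = (- \<kappa>1 * \<alpha>) *\<^sub>R T e1 + (- \<kappa>2 * \<beta>) *\<^sub>R T e2"
    by (simp add: N.add N.scaleR Ne mult.commute)
  have aT: "incident_dir r u \<bullet> T (\<alpha> *\<^sub>R e1 + \<beta> *\<^sub>R e2) = m"
    unfolding Tv by (simp add: inner_add_right a1_def a2_def m_def mult.commute)
  have aN: "incident_dir r u \<bullet> N (\<alpha> *\<^sub>R e1 + \<beta> *\<^sub>R e2) = - q"
    unfolding Nv by (simp add: inner_diff_right q_def mult_ac flip: a1_def a2_def)
  have an: "incident_dir r u \<bullet> n u = c" by (simp add: c_def cos_incidence_def)
  have b: "reflected_dir r n u \<bullet> T e1 = a1" "reflected_dir r n u \<bullet> T e2 = a2"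
    "reflected_dir r n u \<bullet> n u = - c"
    unfolding reflected_dir_def an by (simp_all add: inner_diff_left E' nn an flip: a1_def a2_def)
  define d where "d = reflected_deriv (\<alpha> *\<^sub>R e1 + \<beta> *\<^sub>R e2)"
  have d: "d \<bullet> T e1 = \<alpha> / \<rho> - m * a1 / \<rho> + 2 * c * \<kappa>1 * \<alpha>"
    "d \<bullet> T e2 = \<beta> / \<rho> - m * a2 / \<rho> + 2 * c * \<kappa>2 * \<beta>"
    "d \<bullet> n u = m * c / \<rho> + 2 * q"
    unfolding d_def reflected_deriv_def aT aN unfolding Tv Nv
    by (simp_all add: inner_diff_left inner_add_left E E' nn Tn an diff_divide_distrib algebra_simps
        flip: a1_def a2_def)
  have c: "c \<noteq> 0" using c_neg by simp
  have "T (\<alpha> *\<^sub>R e1 + \<beta> *\<^sub>R e2) + t *\<^sub>R d + s *\<^sub>R reflected_dir r n u = 0 \<longleftrightarrow>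
     \<alpha> + t * (\<alpha> / \<rho> - m * a1 / \<rho> + 2 * c * \<kappa>1 * \<alpha>) + s * a1 = 0 \<and>
     \<beta> + t * (\<beta> / \<rho> - m * a2 / \<rho> + 2 * c * \<kappa>2 * \<beta>) + s * a2 = 0 \<and>
     t * (m * c / \<rho> + 2 * q) - s * c = 0"
    unfolding eq_iff[of _ 0] unfolding Tv by (simp add: inner_add_left E E' Tn b d)
  also have "t * (m * c / \<rho> + 2 * q) - s * c = 0 \<longleftrightarrow> s = t * (m / \<rho> + 2 * q / c)"
    using c by (auto simp: field_simps)
  finally have *: "T (\<alpha> *\<^sub>R e1 + \<beta> *\<^sub>R e2) + t *\<^sub>R d + s *\<^sub>R reflected_dir r n u = 0 \<longleftrightarrow>
     \<alpha> + t * (\<alpha> / \<rho> - m * a1 / \<rho> + 2 * c * \<kappa>1 * \<alpha>) + s * a1 = 0 \<and>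
     \<beta> + t * (\<beta> / \<rho> - m * a2 / \<rho> + 2 * c * \<kappa>2 * \<beta>) + s * a2 = 0 \<and>
     s = t * (m / \<rho> + 2 * q / c)" .
  \<comment> \<open>Inserting s cancels the terms with m / \<rho>, which come from the projection in
    the derivative of a; the term 2 q / c supplies the w w^T part of M.\<close>
  have 1: "\<alpha> + t * (\<alpha> / \<rho> - m * a1 / \<rho> + 2 * c * \<kappa>1 * \<alpha>) + t * (m / \<rho> + 2 * q / c) * a1
     = m11 t * \<alpha> + m12 t * \<beta>"
    unfolding m11_def m12_def q_def using c by (simp add: algebra_simps power2_eq_square add_divide_distrib)
  have 2: "\<beta> + t * (\<beta> / \<rho> - m * a2 / \<rho> + 2 * c * \<kappa>2 * \<beta>) + t * (m / \<rho> + 2 * q / c) * a2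
     = m21 t * \<alpha> + m22 t * \<beta>"
    unfolding m21_def m22_def q_def using c by (simp add: algebra_simps power2_eq_square add_divide_distrib)
  show ?thesis
    using * 1 2 unfolding d_def ray_coeff_def m_def[symmetric] q_def[symmetric] by metis
qed

text \<open>The kernel is the image of the kernel of the 2x2 matrix under \<open>g\<close>, the
  graph of \<open>ray_coeff\<close> over the parameter plane; \<open>g\<close> is linear and
  injective, so dimensions agree.\<close>

lemma focal_multiplicity_eq:
  "focal_multiplicity r (reflected_dir r n) u t =
    (if m11 t * m22 t - m12 t * m21 t \<noteq> 0 then 0
     else if m11 t = 0 \<and> m12 t = 0 \<and> m21 t = 0 \<and> m22 t = 0 then 2 else 1)"
proof -
  define g where "g = (\<lambda>(\<alpha>, \<beta>). (\<alpha> *\<^sub>R e1 + \<beta> *\<^sub>R e2, ray_coeff t \<alpha> \<beta>))"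
  have lin: "linear g"
    by (intro linearI) (auto simp: g_def ray_coeff_def algebra_simps add_divide_distrib)
  have "inj g" by (auto simp: inj_def g_def frame_ind)
  have "{x. frechet_derivative (ray_map r (reflected_dir r n)) (at (u, t)) x = 0} =
     g ` {(\<alpha>, \<beta>). m11 t * \<alpha> + m12 t * \<beta> = 0 \<and> m21 t * \<alpha> + m22 t * \<beta> = 0}" (is "?K = g ` ?S")
  proof (intro set_eqI iffI)
    fix x assume x: "x \<in> ?K"
    obtain v s where vs: "x = (v, s)" by fastforce
    obtain \<alpha> \<beta> where "v = \<alpha> *\<^sub>R e1 + \<beta> *\<^sub>R e2" by (rule frame_coords)
    then show "x \<in> g ` ?S"
      using x by (auto simp: vs ray_map_derivative ray_map_kernel_iff g_def image_iff)
  qed (auto simp: ray_map_derivative ray_map_kernel_iff g_def)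
  then show ?thesis
    unfolding focal_multiplicity_def
    using dim_image_eq[OF lin inj_on_subset[OF \<open>inj g\<close>]] by (simp add: dim_kernel_2x2)
qed

text \<open>For t /= 0 the determinant is t^2 (1/t - k1) (1/t - k2), so the matrix is singular
  exactly at reciprocals of roots; by the equality case of the discriminant inequality it is zero
  exactly at a double root.\<close>

lemma focal_multiplicity_roots:
  assumes k: "reflection_poly r n u = [:- k1, 1:] * [:- k2, 1:]"
  shows "focal_multiplicity r (reflected_dir r n) u t
    = of_bool (k1 \<noteq> 0 \<and> t = 1 / k1) + of_bool (k2 \<noteq> 0 \<and> t = 1 / k2)"
proof (cases "t = 0")
  \<comment> \<open>At t = 0 the matrix is the identity. The guards \<open>k1 \<noteq> 0\<close> and
    \<open>k2 \<noteq> 0\<close> matter here, since 1 / 0 = 0 would count a focal point at infinity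
    as one on the surface.\<close>
  case True
  then show ?thesis
    unfolding focal_multiplicity_eq by (simp add: m11_def m12_def m21_def m22_def)
next
  case t: False
  define p q where "p = a1 / c" and "q = a2 / c"
  \<comment> \<open>x is the candidate for k*, and y is the shifted unknown k* + 1/\<rho> of the
    quadratic.\<close>
  define x y where "x = 1 / t" and "y = x + 1 / \<rho>"
  define A B where "A = \<kappa>1 * (1 + p\<^sup>2)" and "B = \<kappa>2 * (1 + q\<^sup>2)"
  have x: "t * x = 1" using t by (simp add: x_def)
  have ks: "k1 + k2 = - (2 / \<rho> + 2 * c * (A + B))"
    "k1 * k2 = (1 / \<rho>)\<^sup>2 + 2 * c * (A + B) / \<rho> + 4 * (\<kappa>1 * \<kappa>2)"
    using k unfolding factors_iff by (auto simp: tr_def A_def B_def p_def q_def)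
  have m: "m11 t = t * (y + 2 * c * A)" "m12 t = t * (2 * c * (\<kappa>2 * (p * q)))"
    "m21 t = t * (2 * c * (\<kappa>1 * (p * q)))" "m22 t = t * (y + 2 * c * B)"
    using x unfolding m11_def m12_def m21_def m22_def
    by (simp_all add: y_def A_def B_def p_def q_def algebra_simps)
  have cu: "c\<^sup>2 * (1 + p\<^sup>2 + q\<^sup>2) = 1" using c_unit by (simp add: p_def q_def)
  have poly: "(x - k1) * (x - k2) = y\<^sup>2 + 2 * c * (A + B) * y + 4 * (\<kappa>1 * \<kappa>2)"
  proof -
    have "(x - k1) * (x - k2) = x\<^sup>2 - (k1 + k2) * x + k1 * k2"
      by (simp add: algebra_simps power2_eq_square)
    also have "\<dots> = y\<^sup>2 + 2 * c * (A + B) * y + 4 * (\<kappa>1 * \<kappa>2)"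
      unfolding ks y_def by (simp add: algebra_simps add_divide_distrib power2_eq_square)
    finally show ?thesis .
  qed
  have "m11 t * m22 t - m12 t * m21 t
    = t\<^sup>2 * (y\<^sup>2 + 2 * c * (A + B) * y + 4 * (\<kappa>1 * \<kappa>2) * (c\<^sup>2 * (1 + p\<^sup>2 + q\<^sup>2)))"
    unfolding m by (simp add: A_def B_def algebra_simps power2_eq_square)
  also have "\<dots> = t\<^sup>2 * ((x - k1) * (x - k2))" unfolding cu poly by simp
  finally have det: "m11 t * m22 t - m12 t * m21 t = t\<^sup>2 * ((x - k1) * (x - k2))" .
  have double: "m11 t = 0 \<and> m12 t = 0 \<and> m21 t = 0 \<and> m22 t = 0 \<longleftrightarrow> x = k1 \<and> x = k2"
  proof
    assume z: "m11 t = 0 \<and> m12 t = 0 \<and> m21 t = 0 \<and> m22 t = 0"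
    then have "y + 2 * c * A = 0" "y + 2 * c * B = 0" using t m by auto
    then have "k1 + k2 = 2 * x" unfolding ks y_def by (simp add: algebra_simps)
    moreover have "x = k1 \<or> x = k2" using det z t by simp
    ultimately show "x = k1 \<and> x = k2" by auto
  next
    assume z: "x = k1 \<and> x = k2"
    \<comment> \<open>A double root puts y at the vertex of the quadratic. Hence y^2 = 4K, so K >=
      0, and c^2 (tr M)^2 = 4K is equality in the discriminant inequality.\<close>
    have y: "y = - (c * (A + B))" using ks(1) z unfolding y_def by (simp add: algebra_simps)
    have root: "(x - k1) * (x - k2) = 0" using z by simp
    have "2 * c * (A + B) * y = - (2 * y\<^sup>2)"
      unfolding y by (simp add: algebra_simps power2_eq_square)
    then have y2: "y\<^sup>2 = 4 * (\<kappa>1 * \<kappa>2)" using poly[unfolded root] by linarith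
    have "c\<^sup>2 * (A + B)\<^sup>2 = y\<^sup>2" unfolding y by (simp add: power_mult_distrib)
    also have "\<dots> = 4 * (\<kappa>1 * \<kappa>2) * (c\<^sup>2 * (1 + p\<^sup>2 + q\<^sup>2))" unfolding cu y2 by simp
    finally have "c\<^sup>2 * (A + B)\<^sup>2 = c\<^sup>2 * (4 * \<kappa>1 * \<kappa>2 * (1 + p\<^sup>2 + q\<^sup>2))" by (simp only: mult_ac)
    moreover have "c\<^sup>2 \<noteq> 0" using c_neg by simp
    ultimately have "(A + B)\<^sup>2 = 4 * \<kappa>1 * \<kappa>2 * (1 + p\<^sup>2 + q\<^sup>2)"
      using mult_left_cancel by blast
    moreover have "\<kappa>1 * \<kappa>2 \<ge> 0" using y2 zero_le_power2[of y] by simp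
    ultimately have "A = B" "\<kappa>1 * (p * q) = 0" "\<kappa>2 * (p * q) = 0"
      using reflection_discriminant_zero[of \<kappa>1 \<kappa>2 p q] unfolding A_def B_def by blast+
    then show "m11 t = 0 \<and> m12 t = 0 \<and> m21 t = 0 \<and> m22 t = 0"
      unfolding m using y by simp
  qed
  have root: "k \<noteq> 0 \<and> t = 1 / k \<longleftrightarrow> x = k" for k using t by (auto simp: x_def)
  show ?thesis unfolding focal_multiplicity_eq det double root using t by auto
qed

end

section \<open>Principal frames on a regular surface\<close>

lemma smooth_on_differentiable:
  assumes "smooth_on f S" "x \<in> S"
  shows "(f has_derivative frechet_derivative f (at x)) (at x)"
    and "((\<lambda>y. frechet_derivative f (at y) v) has_derivative
      frechet_derivative (\<lambda>y. frechet_derivative f (at y) v) (at x)) (at x)"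
proof -
  have "Ck_on (Suc (Suc 0)) f S" using assms(1) unfolding smooth_on_def by blast
  then have "f differentiable (at x)" "(\<lambda>y. frechet_derivative f (at y) v) differentiable (at x)"
    using assms(2) by auto
  then show "(f has_derivative frechet_derivative f (at x)) (at x)"
    "((\<lambda>y. frechet_derivative f (at y) v) has_derivative
      frechet_derivative (\<lambda>y. frechet_derivative f (at y) v) (at x)) (at x)"
    by (simp_all only: frechet_derivative_works)
qed

lemma linear_axis_eq_0:
  fixes f :: "real^2 \<Rightarrow> real"
  assumes "linear f" "\<And>i. f (axis i 1) = 0"
  shows "f v = 0"
  unfolding linear_axis_expansion[OF assms(1), of v] by (simp add: assms(2))

lemma constant_on_open_derivative_0:
  assumes "open S" "x \<in> S" "\<And>y. y \<in> S \<Longrightarrow> f y = c" "(f has_derivative f') (at x)"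
  shows "f' = (\<lambda>h. 0)"
proof -
  have "((\<lambda>y. c) has_derivative f') (at x)"
    by (rule has_derivative_transform_within_open[OF assms(4,1,2)]) (rule assms(3))
  then show ?thesis using has_derivative_unique[OF _ has_derivative_const] by blast
qed

text \<open>Differentiating (n, n) = 1 shows that \<open>N\<close> is tangential; differentiating (T
  v, n) = 0 expresses (T v, N w) as minus the normal component of the second derivative of
  \<open>r\<close>, which is symmetric. This is what \<open>principal_frame\<close>
  requires.\<close>

lemma reflection_frame_exists:
  fixes r n :: "real^2 \<Rightarrow> real^3" and D :: "(real^2) set"
  assumes D: "open D" "u \<in> D" and reg: "regular_surface r D" and r0: "r u \<noteq> 0"
    and nf: "unit_normal_field n r D" and neg: "incident_dir r u \<bullet> n u < 0"
  obtains T N e1 e2 \<kappa>1 \<kappa>2 where "reflection_frame r n u T N e1 e2 \<kappa>1 \<kappa>2"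
proof -
  define T where "T y = frechet_derivative r (at y)" for y
  define N where "N y = frechet_derivative n (at y)" for y
  define L where "L v = frechet_derivative (\<lambda>y. T y v) (at u)" for v
  have sm: "smooth_on r D" "smooth_on n D"
    using reg nf unfolding regular_surface_def unit_normal_field_def by auto
  have r': "(r has_derivative T y) (at y)" and n': "(n has_derivative N y) (at y)" if "y \<in> D" for y
    using smooth_on_differentiable(1) sm that unfolding T_def N_def by blast+
  have L: "((\<lambda>y. T y v) has_derivative L v) (at u)" for v
    using smooth_on_differentiable(2)[OF sm(1) D(2)] unfolding L_def T_def .
  have inj: "inj (T u)" using reg D(2) unfolding regular_surface_def T_def by blast
  have nn: "n y \<bullet> n y = 1" if "y \<in> D" for y
    using nf that unfolding unit_normal_field_def by (simp add: dot_square_norm)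
  have Tn: "T y v \<bullet> n y = 0" if "y \<in> D" for y v
  proof (rule linear_axis_eq_0[where f = "\<lambda>v. T y v \<bullet> n y"])
    show "linear (\<lambda>v. T y v \<bullet> n y)"
      using has_derivative_linear[OF r'[OF that]]
      by (intro linearI) (simp_all add: linear_add linear_scale inner_add_left)
    show "T y (axis i 1) \<bullet> n y = 0" for i
      using nf that unfolding unit_normal_field_def partial_deriv_def T_def by (simp add: inner_commute)
  qed
  have Nn: "N u v \<bullet> n u = 0" for v
  proof -
    have "((\<lambda>y. n y \<bullet> n y) has_derivative (\<lambda>v. n u \<bullet> N u v + N u v \<bullet> n u)) (at u)"
      by (rule has_derivative_inner n' D)+
    from fun_cong[OF constant_on_open_derivative_0[OF D nn this], of v] show ?thesis
      by (simp add: inner_commute)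
  qed
  have TN: "T u v \<bullet> N u w = - (L v w \<bullet> n u)" for v w
  proof -
    have "((\<lambda>y. T y v \<bullet> n y) has_derivative (\<lambda>w. T u v \<bullet> N u w + L v w \<bullet> n u)) (at u)"
      by (rule has_derivative_inner n' D L)+
    from fun_cong[OF constant_on_open_derivative_0[OF D Tn this], of w] show ?thesis by simp
  qed
  \<comment> \<open>The normal is frozen at u, so that the real-valued height function of the
    surface over its tangent plane direction \<open>n u\<close> can be differentiated twice.\<close>
  have "L v w \<bullet> n u = L w v \<bullet> n u" for v w
    by (rule symmetric_second_derivative[OF D, where f = "\<lambda>y. r y \<bullet> n u" and f' = "\<lambda>y v. T y v \<bullet> n u"
          and Lv = "\<lambda>w. L v w \<bullet> n u" and Lw = "\<lambda>v. L w v \<bullet> n u"])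
       (auto intro!: has_derivative_inner_left r' L)
  then have sym: "T u v \<bullet> N u w = T u w \<bullet> N u v" for v w by (simp add: TN)
  obtain e1 e2 \<kappa>1 \<kappa>2 where "T u e1 \<bullet> T u e1 = 1" "T u e2 \<bullet> T u e2 = 1" "T u e1 \<bullet> T u e2 = 0"
    "N u e1 = - \<kappa>1 *\<^sub>R T u e1" "N u e2 = - \<kappa>2 *\<^sub>R T u e2"
    using principal_frame[OF has_derivative_linear[OF r'] has_derivative_linear[OF n'] inj nn Tn Nn sym] D(2)
    by blast
  then have "reflection_frame r n u (T u) (N u) e1 e2 \<kappa>1 \<kappa>2"
    using D r' n' inj nn Tn Nn r0 neg by unfold_locales auto
  then show ?thesis by (rule that)
qed

section \<open>Caustic sheets over local domains\<close>

lemma proots_two_linear_factors: "proots ([:- a, 1:] * [:- b, 1:]) = {#a, b#}" for a b :: real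
proof -
  have "[:- a, 1:] * [:- b, 1:] \<noteq> 0" by (intro no_zero_divisors) auto
  then show ?thesis by (subst proots_mult) auto
qed

theorem theorem2p1:
  fixes r n :: "real^2 \<Rightarrow> real^3" and D :: "(real^2) set"
  assumes "open D" and "connected D" and "D \<noteq> {}"
    and "regular_surface r D"
    and "\<forall>u\<in>D. r u \<noteq> 0"
    and "unit_normal_field n r D"
    and "\<forall>u\<in>D. incident_dir r u \<bullet> n u < 0"
  shows
    "(\<exists>k :: 2 \<Rightarrow> real^2 \<Rightarrow> real. \<forall>u\<in>D. proots (reflection_poly r n u) = {#k 1 u, k 2 u#}) \<and>
     (\<forall>U (k :: 2 \<Rightarrow> real^2 \<Rightarrow> real).
        open U \<and> connected U \<and> U \<subseteq> D \<and>
        (\<forall>u\<in>U. proots (reflection_poly r n u) = {#k 1 u, k 2 u#}) \<longrightarrow>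
          (\<forall>i. (\<forall>u\<in>U. k i u \<noteq> 0) \<longrightarrow>
             (\<forall>u\<in>U. focal_param r (reflected_dir r n) u (1 / k i u)) \<and>
             caustic_sheet r n (k i) ` U \<subseteq> caustic r (reflected_dir r n) U) \<and>
          caustic r (reflected_dir r n) U =
            (\<Union>i. caustic_sheet r n (k i) ` {u\<in>U. k i u \<noteq> 0}) \<and>
          (\<forall>u\<in>U. \<forall>t. focal_multiplicity r (reflected_dir r n) u t =
                       card {i. k i u \<noteq> 0 \<and> t = 1 / k i u}))"
proof (intro conjI allI impI)
  \<comment> \<open>These facts make no reference to a frame; at each point one is chosen to prove
    them and then discarded.\<close>
  have splits: "\<exists>k1 k2. reflection_poly r n u = [:- k1, 1:] * [:- k2, 1:]"
    and mult: "reflection_poly r n u = [:- k1, 1:] * [:- k2, 1:] \<Longrightarrow>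
      focal_multiplicity r (reflected_dir r n) u t
        = of_bool (k1 \<noteq> 0 \<and> t = 1 / k1) + of_bool (k2 \<noteq> 0 \<and> t = 1 / k2)"
    and lin: "linear (frechet_derivative (ray_map r (reflected_dir r n)) (at (u, t)))"
    if u: "u \<in> D" for u k1 k2 t
  proof -
    obtain T N e1 e2 \<kappa>1 \<kappa>2 where "reflection_frame r n u T N e1 e2 \<kappa>1 \<kappa>2"
      using reflection_frame_exists[OF assms(1) u assms(4) _ assms(6)] assms(5,7) u by blast
    then interpret reflection_frame r n u T N e1 e2 \<kappa>1 \<kappa>2 .
    show "\<exists>k1 k2. reflection_poly r n u = [:- k1, 1:] * [:- k2, 1:]"
      using reflection_poly_splits by blast
    show "reflection_poly r n u = [:- k1, 1:] * [:- k2, 1:] \<Longrightarrow>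
      focal_multiplicity r (reflected_dir r n) u t
        = of_bool (k1 \<noteq> 0 \<and> t = 1 / k1) + of_bool (k2 \<noteq> 0 \<and> t = 1 / k2)"
      by (rule focal_multiplicity_roots)
    show "linear (frechet_derivative (ray_map r (reflected_dir r n)) (at (u, t)))"
      by (rule has_derivative_linear[OF ray_map_has_derivative[folded ray_map_derivative]])
  qed
  obtain k1 k2 where k12: "\<And>u. u \<in> D \<Longrightarrow> reflection_poly r n u = [:- k1 u, 1:] * [:- k2 u, 1:]"
    using splits by metis
  \<comment> \<open>Existence of a real labelling of the roots keeps the statement about all
    labellings from being vacuous.\<close>
  show "\<exists>k :: 2 \<Rightarrow> real^2 \<Rightarrow> real. \<forall>u\<in>D. proots (reflection_poly r n u) = {#k 1 u, k 2 u#}"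
    by (rule exI[of _ "\<lambda>i. if i = 1 then k1 else k2"])
       (simp add: k12 proots_two_linear_factors del: mult_pCons_left mult_pCons_right)
  fix U and k :: "2 \<Rightarrow> real^2 \<Rightarrow> real"
  assume U: "open U \<and> connected U \<and> U \<subseteq> D \<and>
    (\<forall>u\<in>U. proots (reflection_poly r n u) = {#k 1 u, k 2 u#})"
  have card: "focal_multiplicity r (reflected_dir r n) u t = card {i. k i u \<noteq> 0 \<and> t = 1 / k i u}"
    if u: "u \<in> U" for u t
  proof -
    have D: "u \<in> D" and "proots (reflection_poly r n u) = {#k 1 u, k 2 u#}" using U u by auto
    then have "{#k1 u, k2 u#} = {#k 1 u, k 2 u#}" by (simp only: k12 proots_two_linear_factors)
    \<comment> \<open>The given labelling may list the chosen roots in either order, and the order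
      may change from point to point.\<close>
    then have "k1 u = k 1 u \<and> k2 u = k 2 u \<or> k1 u = k 2 u \<and> k2 u = k 1 u"
      by (auto simp: add_eq_conv_ex)
    then have "reflection_poly r n u = [:- k 1 u, 1:] * [:- k 2 u, 1:]"
      using k12[OF D] by (metis mult.commute)
    from mult[OF D this] show ?thesis unfolding card_index_2 .
  qed
  then show "\<forall>u\<in>U. \<forall>t. focal_multiplicity r (reflected_dir r n) u t =
    card {i. k i u \<noteq> 0 \<and> t = 1 / k i u}" by blast
  have focal: "focal_param r (reflected_dir r n) u t \<longleftrightarrow> (\<exists>i. k i u \<noteq> 0 \<and> t = 1 / k i u)"
    if u: "u \<in> U" for u t
  proof -
    let ?F = "frechet_derivative (ray_map r (reflected_dir r n)) (at (u, t))"
    have lin: "linear ?F" using lin U u by blast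
    \<comment> \<open>A parameter is focal iff its nullity is positive, that is, iff some index is
      counted by the multiplicity formula.\<close>
    have "inj ?F \<longleftrightarrow> {x. ?F x = 0} \<subseteq> {0}" unfolding linear_injective_0[OF lin] by blast
    also have "\<dots> \<longleftrightarrow> focal_multiplicity r (reflected_dir r n) u t = 0"
      unfolding focal_multiplicity_def by (simp add: dim_eq_0)
    also have "\<dots> \<longleftrightarrow> {i. k i u \<noteq> 0 \<and> t = 1 / k i u} = {}"
      unfolding card[OF u] by (simp only: card_0_eq[OF finite])
    finally show ?thesis unfolding focal_param_def by blast
  qed
  show "caustic r (reflected_dir r n) U = (\<Union>i. caustic_sheet r n (k i) ` {u\<in>U. k i u \<noteq> 0})"
    unfolding caustic_def caustic_sheet_def ray_map_def using focal by (auto 4 4)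
  fix i assume nz: "\<forall>u\<in>U. k i u \<noteq> 0"
  then show "\<forall>u\<in>U. focal_param r (reflected_dir r n) u (1 / k i u)" using focal by blast
  then show "caustic_sheet r n (k i) ` U \<subseteq> caustic r (reflected_dir r n) U"
    unfolding caustic_def caustic_sheet_def ray_map_def by auto
qed

end
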